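(* Let $\mathcal L_2 \subset \mathbb C[S_2]$ be the set of Lie elements with respect to the permutation representation $\mathbb C^2$ of $S_2$. Then $\dim \mathcal L_2 = 1$; the space $\mathcal L_2$ is spanned by $1 - (12)$, it is a trivial (i.e. abelian) Lie algebra with respect to the bracket $[p,q] = pq - qp$, and it is a trivial representation of $S_2$ (with $S_2$ acting by conjugation).
   Context: Let $V$ be a finite-dimensional representation of a group $G$ over a field $k$. For $g \in G$ and $m \ge 1$ define linear operators $A_m(g), B_m(g): V^{\wedge m} \to V^{\wedge m}$ on the $m$-th exterior power by $$A_m(g)(v_1 \wedge \dots \wedge v_m) = g(v_1) \wedge \dots \wedge g(v_m),$$ $$B_m(g)(v_1 \wedge \dots \wedge v_m) = \sum_{p=1}^m v_1 \wedge \dots \wedge g(v_p) \wedge \dots \wedge v_m$$ (in the $p$-th summand only $v_p$ is replaced by $g(v_p)$). For $m = 0$ set $A_0(g) = 1$ and $B_0(g) = 0$ as operators $k \to k$. Extend $A_m$ and $B_m$ by $k$-linearity to maps $k[G] \to \operatorname{End}(V^{\wedge m})$. An element $x \in k[G]$ is called a Lie element (with respect to $V$) if $A_m(x) = B_m(x)$ for all $m = 0, 1, \dots, \dim V$; the set of Lie elements is denoted $\mathcal L(V)$. For $G = S_n$, $k = \mathbb C$, let $\mathbb C^n$ be the permutation representation: $S_n$ permutes the basis $x_1, \dots, x_n$ by $\sigma(x_i) = x_{\sigma(i)}$. Write $\mathcal L_n = \mathcal L(\mathbb C^n) \subset \mathbb C[S_n]$. *)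

theory Defs
  imports Complex_Main "HOL-Algebra.Sym_Groups" "HOL-Library.Function_Algebras"
begin

section \<open>Free vector spaces\<close>

text \<open>
  Vectors over a basis are functions into the field with pointwise addition. Beware that
  \<open>Function_Algebras\<close> also provides a pointwise \<open>*\<close> and \<open>1\<close>; neither is the multiplication or
  the unit of the group algebra, for which see \<open>ga_mult\<close> below.
\<close>

definition fscale :: "'k::field \<Rightarrow> ('a \<Rightarrow> 'k) \<Rightarrow> 'a \<Rightarrow> 'k"
  where "fscale c f = (\<lambda>a. c * f a)"

interpretation fv: vector_space fscale
  by unfold_locales (auto simp: fscale_def fun_eq_iff algebra_simps)

definition supp :: "('a \<Rightarrow> 'k::field) \<Rightarrow> 'a set"
  where "supp f = {a. f a \<noteq> 0}"

definition delta :: "'a \<Rightarrow> 'a \<Rightarrow> 'k::field"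
  where "delta a = (\<lambda>b. if b = a then 1 else 0)"

definition free_space :: "'a set \<Rightarrow> ('a \<Rightarrow> 'k::field) set"
  where "free_space S = {f. finite (supp f) \<and> supp f \<subseteq> S}"

definition lin_ext :: "('a \<Rightarrow> 'b \<Rightarrow> 'k::field) \<Rightarrow> ('a \<Rightarrow> 'k) \<Rightarrow> 'b \<Rightarrow> 'k"
  where "lin_ext T f = (\<Sum>a\<in>supp f. fscale (f a) (T a))"

lemma lin_ext_superset:
  assumes "finite S" "supp f \<subseteq> S"
  shows "lin_ext T f = (\<Sum>a\<in>S. fscale (f a) (T a))"
  unfolding lin_ext_def
  by (rule sum.mono_neutral_left) (use assms in \<open>auto simp: supp_def fscale_def fun_eq_iff\<close>)

lemma supp_simps [simp]:
  "supp (0 :: 'a \<Rightarrow> 'k::field) = {}" "supp (delta a :: 'a \<Rightarrow> 'k) = {a}"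
  by (auto simp: supp_def delta_def)

lemma supp_add: "supp (f + h) \<subseteq> supp f \<union> supp h"
  and supp_diff: "supp (f - h) \<subseteq> supp f \<union> supp h"
  and supp_fscale: "supp (fscale c f) \<subseteq> supp f"
  by (auto simp: supp_def fscale_def)

lemma lin_ext_delta [simp]: "lin_ext T (delta a) = T a"
  by (simp add: lin_ext_def) (simp add: delta_def)

lemma lin_ext_0 [simp]: "lin_ext T 0 = 0"
  by (simp add: lin_ext_def)

lemma lin_ext_add:
  assumes "finite (supp f)" "finite (supp h)"
  shows "lin_ext T (f + h) = lin_ext T f + lin_ext T h"
proof -
  let ?S = "supp f \<union> supp h"
  have "finite ?S" using assms by simp
  then show ?thesis
    by (simp add: lin_ext_superset[of ?S] supp_add fv.scale_left_distrib sum.distrib)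
qed

lemma lin_ext_fscale:
  assumes "finite (supp f)"
  shows "lin_ext T (fscale c f) = fscale c (lin_ext T f)"
  using assms
  by (simp add: lin_ext_superset[of "supp f"] supp_fscale fv.scale_sum_right)
     (simp add: fscale_def mult.assoc)

lemma lin_ext_diff:
  assumes "finite (supp f)" "finite (supp h)"
  shows "lin_ext T (f - h) = lin_ext T f - lin_ext T h"
proof -
  let ?S = "supp f \<union> supp h"
  have "finite ?S" using assms by simp
  then show ?thesis
    by (simp add: lin_ext_superset[of ?S] supp_diff fv.scale_left_diff_distrib sum_subtractf)
qed

lemma subspace_free_space: "fv.subspace (free_space S :: ('a \<Rightarrow> 'k::field) set)"
proof (rule fv.subspaceI)
  fix f h :: "'a \<Rightarrow> 'k" and c :: 'k
  show "0 \<in> (free_space S :: ('a \<Rightarrow> 'k) set)"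
    by (simp add: free_space_def)
  assume f: "f \<in> free_space S"
  then show "fscale c f \<in> free_space S"
    using supp_fscale[of c f] by (auto simp: free_space_def intro: finite_subset)
  assume "h \<in> free_space S"
  with f show "f + h \<in> free_space S"
    using supp_add[of f h] by (auto simp: free_space_def intro: finite_subset)
qed

lemma delta_in_free_space: "a \<in> S \<Longrightarrow> delta a \<in> free_space S"
  by (simp add: free_space_def)

lemma lin_ext_in_subspace:
  assumes "fv.subspace U" "\<And>a. a \<in> supp f \<Longrightarrow> T a \<in> U"
  shows "lin_ext T f \<in> U"
  unfolding lin_ext_def
  by (intro fv.subspace_sum fv.subspace_scale assms)


section \<open>Group algebras\<close>

text \<open>The group element \<open>g\<close>, seen in the group algebra, is \<open>delta g\<close>.\<close>

definition group_algebra :: "('g, 'm) monoid_scheme \<Rightarrow> ('g \<Rightarrow> 'k::field) set"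
  where "group_algebra G = free_space (carrier G)"

definition ga_mult :: "('g, 'm) monoid_scheme \<Rightarrow> ('g \<Rightarrow> 'k::field) \<Rightarrow> ('g \<Rightarrow> 'k) \<Rightarrow> 'g \<Rightarrow> 'k"
  where "ga_mult G x y = lin_ext (\<lambda>g. lin_ext (\<lambda>h. delta (g \<otimes>\<^bsub>G\<^esub> h)) y) x"

definition ga_bracket :: "('g, 'm) monoid_scheme \<Rightarrow> ('g \<Rightarrow> 'k::field) \<Rightarrow> ('g \<Rightarrow> 'k) \<Rightarrow> 'g \<Rightarrow> 'k"
  where "ga_bracket G x y = ga_mult G x y - ga_mult G y x"

definition ga_conj :: "('g, 'm) monoid_scheme \<Rightarrow> 'g \<Rightarrow> ('g \<Rightarrow> 'k::field) \<Rightarrow> 'g \<Rightarrow> 'k"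
  where "ga_conj G g x = ga_mult G (ga_mult G (delta g) x) (delta (inv\<^bsub>G\<^esub> g))"

definition ga_lie_subalgebra :: "('g, 'm) monoid_scheme \<Rightarrow> ('g \<Rightarrow> 'k::field) set \<Rightarrow> bool"
  where "ga_lie_subalgebra G L \<longleftrightarrow>
    L \<subseteq> group_algebra G \<and> fv.subspace L \<and> (\<forall>x\<in>L. \<forall>y\<in>L. ga_bracket G x y \<in> L)"


section \<open>Representations, exterior powers and Lie elements\<close>

text \<open>The representation space is a linear subspace \<open>V\<close> of an ambient vector space, and
  \<open>\<rho> g\<close> matters only on \<open>V\<close>.\<close>

locale fin_dim_rep =
  group G + vec: vector_space scale
  for G :: "('g, 'm) monoid_scheme" (structure)
    and scale :: "'k::field \<Rightarrow> 'v::ab_group_add \<Rightarrow> 'v" +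
  fixes V :: "'v set" and \<rho> :: "'g \<Rightarrow> 'v \<Rightarrow> 'v"
  assumes subspace_V: "vec.subspace V"
    and finite_dim: "\<exists>B. finite B \<and> B \<subseteq> V \<and> V \<subseteq> vec.span B"
    and rep_closed: "g \<in> carrier G \<Longrightarrow> v \<in> V \<Longrightarrow> \<rho> g v \<in> V"
    and rep_add: "g \<in> carrier G \<Longrightarrow> v \<in> V \<Longrightarrow> w \<in> V \<Longrightarrow> \<rho> g (v + w) = \<rho> g v + \<rho> g w"
    and rep_scale: "g \<in> carrier G \<Longrightarrow> v \<in> V \<Longrightarrow> \<rho> g (scale c v) = scale c (\<rho> g v)"
    and rep_one: "v \<in> V \<Longrightarrow> \<rho> \<one> v = v"
    and rep_mult: "g \<in> carrier G \<Longrightarrow> h \<in> carrier G \<Longrightarrow> v \<in> V \<Longrightarrow> \<rho> (g \<otimes> h) v = \<rho> g (\<rho> h v)"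
begin

text \<open>
  The exterior power of degree \<open>m\<close> is the free vector space on \<open>V\<^sup>m\<close> (words of length \<open>m\<close>)
  modulo multilinearity and the vanishing of words with a repeated entry. Its elements are cosets.
  For \<open>m = 0\<close> the only word is \<open>[]\<close> and there are no relations, so it is a copy of the field.
\<close>

definition words :: "nat \<Rightarrow> 'v list set"
  where "words m = {vs. length vs = m \<and> set vs \<subseteq> V}"

definition ext_generators :: "nat \<Rightarrow> ('v list \<Rightarrow> 'k) set"
  where "ext_generators m =
    {delta (us @ [v + w] @ ws) - delta (us @ [v] @ ws) - delta (us @ [w] @ ws) | us v w ws.
       us @ [v] @ ws \<in> words m \<and> w \<in> V} \<union>
    {delta (us @ [scale c v] @ ws) - fscale c (delta (us @ [v] @ ws)) | us c v ws.
       us @ [v] @ ws \<in> words m} \<union>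
    {delta (us @ [v] @ vs @ [v] @ ws) | us v vs ws. us @ [v] @ vs @ [v] @ ws \<in> words m}"

definition ext_kernel :: "nat \<Rightarrow> ('v list \<Rightarrow> 'k) set"
  where "ext_kernel m = fv.span (ext_generators m)"

definition ext_rel :: "nat \<Rightarrow> (('v list \<Rightarrow> 'k) \<times> ('v list \<Rightarrow> 'k)) set"
  where "ext_rel m =
    {(f, h). f \<in> free_space (words m) \<and> h \<in> free_space (words m) \<and> f - h \<in> ext_kernel m}"

definition ext_power :: "nat \<Rightarrow> ('v list \<Rightarrow> 'k) set set"
  where "ext_power m = free_space (words m) // ext_rel m"

definition ext_class :: "nat \<Rightarrow> ('v list \<Rightarrow> 'k) \<Rightarrow> ('v list \<Rightarrow> 'k) set"
  where "ext_class m f = ext_rel m `` {f}"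

text \<open>\<open>v\<^sub>1 \<and> \<dots> \<and> v\<^sub>m\<close> is \<open>wedge [v\<^sub>1, \<dots>, v\<^sub>m]\<close>.\<close>

definition wedge :: "'v list \<Rightarrow> ('v list \<Rightarrow> 'k) set"
  where "wedge vs = ext_class (length vs) (delta vs)"

text \<open>
  \<open>lift_A x\<close> and \<open>lift_B x\<close> are the two operators on the free space, linear both in the tensor
  and in \<open>x\<close>; \<open>A_op m x\<close> and \<open>B_op m x\<close> are the operators they induce on cosets.
\<close>

definition word_B :: "'g \<Rightarrow> 'v list \<Rightarrow> 'v list \<Rightarrow> 'k"
  where "word_B g vs = (\<Sum>p<length vs. delta (vs[p := \<rho> g (vs ! p)]))"

definition lift_A :: "('g \<Rightarrow> 'k) \<Rightarrow> ('v list \<Rightarrow> 'k) \<Rightarrow> 'v list \<Rightarrow> 'k"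
  where "lift_A x f = lin_ext (\<lambda>g. lin_ext (\<lambda>vs. delta (map (\<rho> g) vs)) f) x"

definition lift_B :: "('g \<Rightarrow> 'k) \<Rightarrow> ('v list \<Rightarrow> 'k) \<Rightarrow> 'v list \<Rightarrow> 'k"
  where "lift_B x f = lin_ext (\<lambda>g. lin_ext (word_B g) f) x"

definition A_op :: "nat \<Rightarrow> ('g \<Rightarrow> 'k) \<Rightarrow> ('v list \<Rightarrow> 'k) set \<Rightarrow> ('v list \<Rightarrow> 'k) set"
  where "A_op m x X = (\<Union>f\<in>X. ext_class m (lift_A x f))"

definition B_op :: "nat \<Rightarrow> ('g \<Rightarrow> 'k) \<Rightarrow> ('v list \<Rightarrow> 'k) set \<Rightarrow> ('v list \<Rightarrow> 'k) set"
  where "B_op m x X = (\<Union>f\<in>X. ext_class m (lift_B x f))"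

definition lie_elements :: "('g \<Rightarrow> 'k) set"
  where "lie_elements =
    {x \<in> group_algebra G. \<forall>m \<le> vec.dim V. \<forall>X \<in> ext_power m. A_op m x X = B_op m x X}"


subsection \<open>The operators are well defined on cosets\<close>

lemma subspace_ext_kernel: "fv.subspace (ext_kernel m)"
  by (simp add: ext_kernel_def)

lemma ext_generators_subset: "ext_generators m \<subseteq> free_space (words m)"
  unfolding ext_generators_def
  using subspace_V
  by (auto intro!: fv.subspace_diff[OF subspace_free_space] fv.subspace_scale[OF subspace_free_space]
      delta_in_free_space simp: words_def vec.subspace_add vec.subspace_scale)

lemma ext_kernel_subset: "ext_kernel m \<subseteq> free_space (words m)"
  unfolding ext_kernel_def
  by (rule fv.span_minimal[OF ext_generators_subset subspace_free_space])

lemma equiv_ext_rel: "equiv (free_space (words m)) (ext_rel m)"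
proof (rule equivI)
  show "ext_rel m \<subseteq> free_space (words m) \<times> free_space (words m)"
    by (auto simp: ext_rel_def)
  show "refl_on (free_space (words m)) (ext_rel m)"
    using fv.subspace_0[OF subspace_ext_kernel, of m] by (auto simp: refl_on_def ext_rel_def)
  show "sym (ext_rel m)"
    using fv.subspace_neg[OF subspace_ext_kernel, of _ m]
    by (force simp: sym_def ext_rel_def)
  show "trans (ext_rel m)"
  proof (rule transI)
    fix f h k assume "(f, h) \<in> ext_rel m" "(h, k) \<in> ext_rel m"
    then show "(f, k) \<in> ext_rel m"
      using fv.subspace_add[OF subspace_ext_kernel, of "f - h" m "h - k"]
      by (auto simp: ext_rel_def)
  qed
qed

lemma multilinear_add:
  "us @ [v] @ ws \<in> words m \<Longrightarrow> w \<in> V \<Longrightarrow>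
    delta (us @ [v + w] @ ws) - delta (us @ [v] @ ws) - delta (us @ [w] @ ws) \<in> ext_kernel m"
  unfolding ext_kernel_def by (rule fv.span_base) (unfold ext_generators_def, blast)

lemma multilinear_scale:
  "us @ [v] @ ws \<in> words m \<Longrightarrow>
    delta (us @ [scale c v] @ ws) - fscale c (delta (us @ [v] @ ws)) \<in> ext_kernel m"
  unfolding ext_kernel_def by (rule fv.span_base) (unfold ext_generators_def, blast)

lemma alternating:
  "us @ [v] @ vs @ [v] @ ws \<in> words m \<Longrightarrow> delta (us @ [v] @ vs @ [v] @ ws) \<in> ext_kernel m"
  unfolding ext_kernel_def by (rule fv.span_base) (unfold ext_generators_def, blast)

lemma antisymmetric:
  assumes "us @ [v] @ vs @ [w] @ ws \<in> words m"
  shows "delta (us @ [v] @ vs @ [w] @ ws) + delta (us @ [w] @ vs @ [v] @ ws) \<in> ext_kernel m"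
proof -
  have in_V: "v \<in> V" "w \<in> V" "v + w \<in> V"
    using assms subspace_V by (auto simp: words_def vec.subspace_add)
  let ?d = "\<lambda>a b. delta (us @ [a] @ vs @ [b] @ ws) :: 'v list \<Rightarrow> 'k"
  have 1: "?d (v + w) (v + w) - ?d v (v + w) - ?d w (v + w) \<in> ext_kernel m"
    using multilinear_add[of us v "vs @ [v + w] @ ws" m w] assms in_V by (simp add: words_def)
  have 2: "?d a (v + w) - ?d a v - ?d a w \<in> ext_kernel m" if "a \<in> V" for a
    using multilinear_add[of "us @ [a] @ vs" v ws m w] assms in_V that by (simp add: words_def)
  have 3: "?d a a \<in> ext_kernel m" if "a \<in> V" for a
    using alternating[of us a vs ws m] assms that by (simp add: words_def)
  have "?d v w + ?d w v =
      ?d (v + w) (v + w) - (?d (v + w) (v + w) - ?d v (v + w) - ?d w (v + w))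
      - (?d v (v + w) - ?d v v - ?d v w) - (?d w (v + w) - ?d w v - ?d w w)
      - ?d v v - ?d w w"
    by simp
  also have "\<dots> \<in> ext_kernel m"
    by (intro fv.subspace_diff[OF subspace_ext_kernel] 1 2 3 in_V)
  finally show ?thesis .
qed

lemma lin_ext_kernel:
  assumes gen: "\<And>r. r \<in> ext_generators m \<Longrightarrow> lin_ext T r \<in> ext_kernel m"
    and f: "f \<in> ext_kernel m"
  shows "lin_ext T f \<in> ext_kernel m"
proof -
  have "f \<in> free_space (words m) \<and> lin_ext T f \<in> ext_kernel m"
    using f unfolding ext_kernel_def
  proof (induction rule: fv.span_induct_alt)
    case base
    show ?case
      using fv.subspace_0[OF subspace_ext_kernel, of m]
        fv.subspace_0[OF subspace_free_space, of "words m"]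
      unfolding ext_kernel_def lin_ext_0 by blast
  next
    case (step c r f)
    have r: "r \<in> free_space (words m)" "lin_ext T r \<in> ext_kernel m"
      using step(1) ext_generators_subset gen by auto
    have cr: "fscale c r \<in> free_space (words m)"
      by (rule fv.subspace_scale[OF subspace_free_space r(1)])
    have "lin_ext T (fscale c r + f) = fscale c (lin_ext T r) + lin_ext T f"
      using r cr step(2) by (simp add: lin_ext_add lin_ext_fscale free_space_def)
    then show ?case
      using step(2) r(2) fv.subspace_add[OF subspace_free_space cr]
      by (metis ext_kernel_def fv.subspace_add fv.subspace_scale subspace_ext_kernel)
  qed
  then show ?thesis ..
qed

lemma lin_ext_gen_cases:
  assumes "r \<in> ext_generators m"
    and "\<And>us v w ws. us @ [v] @ ws \<in> words m \<Longrightarrow> w \<in> V \<Longrightarrow>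
      T (us @ [v + w] @ ws) - T (us @ [v] @ ws) - T (us @ [w] @ ws) \<in> ext_kernel m"
    and "\<And>us c v ws. us @ [v] @ ws \<in> words m \<Longrightarrow>
      T (us @ [scale c v] @ ws) - fscale c (T (us @ [v] @ ws)) \<in> ext_kernel m"
    and "\<And>us v vs ws. us @ [v] @ vs @ [v] @ ws \<in> words m \<Longrightarrow>
      T (us @ [v] @ vs @ [v] @ ws) \<in> ext_kernel m"
  shows "lin_ext T r \<in> ext_kernel m"
proof -
  have fin: "finite (supp (delta a :: 'v list \<Rightarrow> 'k))"
    "finite (supp (delta a - delta b :: 'v list \<Rightarrow> 'k))"
    "finite (supp (fscale c (delta a) :: 'v list \<Rightarrow> 'k))" for a b c
    by (auto intro: finite_subset[OF supp_diff] finite_subset[OF supp_fscale])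
  show ?thesis
    using assms(1) unfolding ext_generators_def Un_iff mem_Collect_eq
    by (elim disjE exE conjE)
       (simp_all only: lin_ext_diff lin_ext_fscale fin lin_ext_delta assms(2-))
qed

lemma map_kernel:
  assumes g: "g \<in> carrier G" and f: "f \<in> ext_kernel m"
  shows "lin_ext (\<lambda>vs. delta (map (\<rho> g) vs)) f \<in> ext_kernel m"
proof (rule lin_ext_kernel[OF _ f], rule lin_ext_gen_cases)
  have map_words: "map (\<rho> g) vs \<in> words m" if "vs \<in> words m" for vs
    using that rep_closed[OF g] by (auto simp: words_def)
  show "delta (map (\<rho> g) (us @ [v + w] @ ws)) - delta (map (\<rho> g) (us @ [v] @ ws))
      - delta (map (\<rho> g) (us @ [w] @ ws)) \<in> ext_kernel m"
    if "us @ [v] @ ws \<in> words m" "w \<in> V" for us v w ws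
    using multilinear_add[of "map (\<rho> g) us" "\<rho> g v" "map (\<rho> g) ws" m "\<rho> g w"]
      map_words[OF that(1)] that rep_add[OF g, of v w] rep_closed[OF g that(2)]
    by (simp add: words_def)
  show "delta (map (\<rho> g) (us @ [scale c v] @ ws)) - fscale c (delta (map (\<rho> g) (us @ [v] @ ws)))
      \<in> ext_kernel m"
    if "us @ [v] @ ws \<in> words m" for us c v ws
    using multilinear_scale[of "map (\<rho> g) us" "\<rho> g v" "map (\<rho> g) ws" m c]
      map_words[OF that(1)] that rep_scale[OF g, of v c]
    by (simp add: words_def)
  show "delta (map (\<rho> g) (us @ [v] @ vs @ [v] @ ws)) \<in> ext_kernel m"
    if "us @ [v] @ vs @ [v] @ ws \<in> words m" for us v vs ws
    using alternating[of "map (\<rho> g) us" "\<rho> g v" "map (\<rho> g) vs" "map (\<rho> g) ws" m]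
      map_words[OF that] by simp
qed

lemma sum_update_append:
  fixes F :: "'v list \<Rightarrow> 'c::comm_monoid_add"
  shows "(\<Sum>p<length (us @ ws). F ((us @ ws)[p := r ((us @ ws) ! p)]))
    = (\<Sum>p<length us. F (us[p := r (us ! p)] @ ws)) + (\<Sum>p<length ws. F (us @ ws[p := r (ws ! p)]))"
proof -
  let ?F = "\<lambda>p. F ((us @ ws)[p := r ((us @ ws) ! p)])"
  have "(\<Sum>p<length (us @ ws). ?F p)
      = (\<Sum>p<length us. ?F p) + (\<Sum>p=length us..<length us + length ws. ?F p)"
    unfolding lessThan_atLeast0 by (simp add: sum.atLeastLessThan_concat)
  also have "(\<Sum>p<length us. ?F p) = (\<Sum>p<length us. F (us[p := r (us ! p)] @ ws))"
    by (rule sum.cong) (auto simp: nth_append list_update_append)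
  also have "(\<Sum>p=length us..<length us + length ws. ?F p)
      = (\<Sum>p<length ws. F (us @ ws[p := r (ws ! p)]))"
    using sum.shift_bounds_nat_ivl[of ?F 0 "length us" "length ws"]
    by (simp add: lessThan_atLeast0 add.commute nth_append list_update_append)
  finally show ?thesis .
qed

lemma sum_update_insert:
  fixes F :: "'v list \<Rightarrow> 'c::comm_monoid_add"
  shows "(\<Sum>p<length (us @ [v] @ ws). F ((us @ [v] @ ws)[p := r ((us @ [v] @ ws) ! p)]))
    = (\<Sum>p<length us. F (us[p := r (us ! p)] @ [v] @ ws)) + F (us @ [r v] @ ws)
      + (\<Sum>p<length ws. F (us @ [v] @ ws[p := r (ws ! p)]))"
  using sum_update_append[of F us "[v] @ ws" r] sum_update_append[of "\<lambda>zs. F (us @ zs)" "[v]" ws r]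
  by (simp only: add.assoc) simp

lemma word_B_insert:
  "word_B g (us @ [v] @ ws) = (\<Sum>p<length us. delta (us[p := \<rho> g (us ! p)] @ [v] @ ws))
    + delta (us @ [\<rho> g v] @ ws) + (\<Sum>p<length ws. delta (us @ [v] @ ws[p := \<rho> g (ws ! p)]))"
  unfolding word_B_def by (rule sum_update_insert)

lemma word_B_kernel:
  assumes g: "g \<in> carrier G" and f: "f \<in> ext_kernel m"
  shows "lin_ext (word_B g) f \<in> ext_kernel m"
proof (rule lin_ext_kernel[OF _ f], rule lin_ext_gen_cases)
  note sub = subspace_ext_kernel
  have upd: "set (us[p := \<rho> g (us ! p)]) \<subseteq> V" if "set us \<subseteq> V" "p < length us" for us p
    using that rep_closed[OF g] set_update_subset_insert[of us p "\<rho> g (us ! p)"] nth_mem[of p us]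
    by blast
  show "word_B g (us @ [v + w] @ ws) - word_B g (us @ [v] @ ws) - word_B g (us @ [w] @ ws)
      \<in> ext_kernel m"
    if h: "us @ [v] @ ws \<in> words m" "w \<in> V" for us v w ws
  proof -
    let ?r = "\<lambda>us v w ws. delta (us @ [v + w] @ ws) - delta (us @ [v] @ ws) - delta (us @ [w] @ ws)
      :: 'v list \<Rightarrow> 'k"
    have "word_B g (us @ [v + w] @ ws) - word_B g (us @ [v] @ ws) - word_B g (us @ [w] @ ws) =
      (\<Sum>p<length us. ?r (us[p := \<rho> g (us ! p)]) v w ws) + ?r us (\<rho> g v) (\<rho> g w) ws
      + (\<Sum>p<length ws. ?r us v w (ws[p := \<rho> g (ws ! p)]))"
      using h rep_add[OF g, of v w] unfolding word_B_insert sum_subtractf by (simp add: words_def)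
    also have "\<dots> \<in> ext_kernel m"
      using h upd rep_closed[OF g]
      by (intro fv.subspace_add[OF sub] fv.subspace_sum[OF sub] multilinear_add)
         (auto simp: words_def)
    finally show ?thesis .
  qed
  show "word_B g (us @ [scale c v] @ ws) - fscale c (word_B g (us @ [v] @ ws)) \<in> ext_kernel m"
    if h: "us @ [v] @ ws \<in> words m" for us c v ws
  proof -
    let ?r = "\<lambda>us v ws. delta (us @ [scale c v] @ ws) - fscale c (delta (us @ [v] @ ws))
      :: 'v list \<Rightarrow> 'k"
    have "word_B g (us @ [scale c v] @ ws) - fscale c (word_B g (us @ [v] @ ws)) =
      (\<Sum>p<length us. ?r (us[p := \<rho> g (us ! p)]) v ws) + ?r us (\<rho> g v) ws
      + (\<Sum>p<length ws. ?r us v (ws[p := \<rho> g (ws ! p)]))"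
      using h rep_scale[OF g, of v c]
      unfolding word_B_insert sum_subtractf fv.scale_right_distrib fv.scale_sum_right
      by (simp add: words_def)
    also have "\<dots> \<in> ext_kernel m"
      using h upd rep_closed[OF g]
      by (intro fv.subspace_add[OF sub] fv.subspace_sum[OF sub] multilinear_scale)
         (auto simp: words_def)
    finally show ?thesis .
  qed
  show "word_B g (us @ [v] @ vs @ [v] @ ws) \<in> ext_kernel m"
    if h: "us @ [v] @ vs @ [v] @ ws \<in> words m" for us v vs ws
  proof -
    let ?d = "\<lambda>us a vs b ws. delta (us @ [a] @ vs @ [b] @ ws) :: 'v list \<Rightarrow> 'k"
    have split: "(\<Sum>p<length (vs @ [v] @ ws). delta (us @ [v] @ (vs @ [v] @ ws)
          [p := \<rho> g ((vs @ [v] @ ws) ! p)]) :: 'v list \<Rightarrow> 'k) =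
        (\<Sum>p<length vs. ?d us v (vs[p := \<rho> g (vs ! p)]) v ws) + ?d us v vs (\<rho> g v) ws
        + (\<Sum>p<length ws. ?d us v vs v (ws[p := \<rho> g (ws ! p)]))"
      using sum_update_insert[of "\<lambda>zs. delta (us @ [v] @ zs)" vs v ws "\<rho> g"] by simp
    have "word_B g (us @ [v] @ vs @ [v] @ ws) =
        (\<Sum>p<length us. ?d (us[p := \<rho> g (us ! p)]) v vs v ws)
        + (?d us (\<rho> g v) vs v ws + ?d us v vs (\<rho> g v) ws)
        + (\<Sum>p<length vs. ?d us v (vs[p := \<rho> g (vs ! p)]) v ws)
        + (\<Sum>p<length ws. ?d us v vs v (ws[p := \<rho> g (ws ! p)]))"
      unfolding word_B_insert[of g us v "vs @ [v] @ ws"] split by (simp only: ac_simps)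
    also have "\<dots> \<in> ext_kernel m"
      using h upd rep_closed[OF g]
      by (intro fv.subspace_add[OF sub] fv.subspace_sum[OF sub] alternating
            antisymmetric[of us "\<rho> g v" vs v ws])
         (auto simp: words_def)
    finally show ?thesis .
  qed
qed

lemma word_B_in_free:
  assumes "g \<in> carrier G" "vs \<in> words m"
  shows "word_B g vs \<in> free_space (words m)"
  unfolding word_B_def
proof (intro fv.subspace_sum[OF subspace_free_space] delta_in_free_space)
  fix p assume "p \<in> {..<length vs}"
  then show "vs[p := \<rho> g (vs ! p)] \<in> words m"
    using assms rep_closed[OF assms(1)] set_update_subset_insert[of vs p "\<rho> g (vs ! p)"]
      nth_mem[of p vs]
    unfolding words_def by fastforce
qed

lemma lift_in_free:
  assumes "x \<in> group_algebra G" "f \<in> free_space (words m)"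
  shows "lift_A x f \<in> free_space (words m)" "lift_B x f \<in> free_space (words m)"
proof -
  have "g \<in> carrier G" if "g \<in> supp x" for g
    using assms(1) that by (auto simp: group_algebra_def free_space_def)
  moreover have "vs \<in> words m" if "vs \<in> supp f" for vs
    using assms(2) that by (auto simp: free_space_def)
  ultimately show "lift_A x f \<in> free_space (words m)" "lift_B x f \<in> free_space (words m)"
    unfolding lift_A_def lift_B_def
    by (auto intro!: lin_ext_in_subspace[OF subspace_free_space] delta_in_free_space word_B_in_free)
       (auto simp: words_def intro!: rep_closed dest: subsetD)
qed

lemma lift_respects:
  assumes x: "x \<in> group_algebra G" and fh: "(f, h) \<in> ext_rel m"
  shows "(lift_A x f, lift_A x h) \<in> ext_rel m" "(lift_B x f, lift_B x h) \<in> ext_rel m"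
proof -
  have fin: "finite (supp f)" "finite (supp h)" and k: "f - h \<in> ext_kernel m"
    and fr: "f \<in> free_space (words m)" "h \<in> free_space (words m)"
    using fh by (auto simp: ext_rel_def free_space_def)
  have car: "g \<in> carrier G" if "g \<in> supp x" for g
    using x that by (auto simp: group_algebra_def free_space_def)
  have diff: "lin_ext (\<lambda>g. lin_ext (T g) f) x - lin_ext (\<lambda>g. lin_ext (T g) h) x
      = lin_ext (\<lambda>g. lin_ext (T g) (f - h)) x" for T :: "'g \<Rightarrow> 'v list \<Rightarrow> 'v list \<Rightarrow> 'k"
    by (simp add: lin_ext_diff[OF fin])
       (simp add: lin_ext_def[where f = x] fv.scale_right_diff_distrib sum_subtractf)
  have "lift_A x f - lift_A x h \<in> ext_kernel m" "lift_B x f - lift_B x h \<in> ext_kernel m"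
    unfolding lift_A_def lift_B_def diff
    by (rule lin_ext_in_subspace[OF subspace_ext_kernel], erule map_kernel[OF car k],
        rule lin_ext_in_subspace[OF subspace_ext_kernel], erule word_B_kernel[OF car k])
  then show "(lift_A x f, lift_A x h) \<in> ext_rel m" "(lift_B x f, lift_B x h) \<in> ext_rel m"
    using lift_in_free[OF x] fr by (auto simp: ext_rel_def)
qed

lemma op_class:
  assumes x: "x \<in> group_algebra G" and f: "f \<in> free_space (words m)"
  shows "A_op m x (ext_class m f) = ext_class m (lift_A x f)"
    and "B_op m x (ext_class m f) = ext_class m (lift_B x f)"
  unfolding A_op_def B_op_def ext_class_def
  by (auto intro!: UN_equiv_class[OF equiv_ext_rel _ f] congruentI
      equiv_class_eq[OF equiv_ext_rel] lift_respects[OF x])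

lemma op_wedge:
  assumes x: "x \<in> group_algebra G" and vs: "set vs \<subseteq> V"
  shows "A_op (length vs) x (wedge vs)
      = ext_class (length vs) (\<Sum>g\<in>supp x. fscale (x g) (delta (map (\<rho> g) vs)))"
    and "B_op (length vs) x (wedge vs)
      = ext_class (length vs)
          (\<Sum>g\<in>supp x. fscale (x g) (\<Sum>p<length vs. delta (vs[p := \<rho> g (vs ! p)])))"
proof -
  have "delta vs \<in> free_space (words (length vs))"
    using vs by (simp add: delta_in_free_space words_def)
  from op_class[OF x this] show
    "A_op (length vs) x (wedge vs)
      = ext_class (length vs) (\<Sum>g\<in>supp x. fscale (x g) (delta (map (\<rho> g) vs)))"
    "B_op (length vs) x (wedge vs)
      = ext_class (length vs)
          (\<Sum>g\<in>supp x. fscale (x g) (\<Sum>p<length vs. delta (vs[p := \<rho> g (vs ! p)])))"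
    by (simp_all add: wedge_def lift_A_def lift_B_def lin_ext_def[where f = x] word_B_def)
qed

end


section \<open>The permutation representation\<close>

text \<open>\<open>\<complex>\<^sup>n\<close> is \<open>free_space {1..n}\<close> inside \<open>nat \<Rightarrow> complex\<close>, with basis \<open>x\<^sub>i = delta i\<close>.\<close>

definition perm_rep :: "(nat \<Rightarrow> nat) \<Rightarrow> (nat \<Rightarrow> complex) \<Rightarrow> nat \<Rightarrow> complex"
  where "perm_rep \<sigma> = lin_ext (\<lambda>i. delta (\<sigma> i))"

lemma fin_dim_rep_perm_rep: "fin_dim_rep (sym_group n) fscale (free_space {1..n}) perm_rep"
proof -
  interpret group "sym_group n" by (rule sym_group_is_group)
  have expand: "v = lin_ext delta v" if "v \<in> free_space {1..n}" for v :: "nat \<Rightarrow> complex"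
  proof
    fix i
    have *: "sum F A i = (\<Sum>a\<in>A. F a i)" for F :: "nat \<Rightarrow> nat \<Rightarrow> complex" and A
      by (induction A rule: infinite_finite_induct) auto
    have "finite (supp v)" using that by (simp add: free_space_def)
    moreover have "i \<notin> supp v \<Longrightarrow> v i = 0" by (simp add: supp_def)
    ultimately show "v i = lin_ext delta v i"
      by (auto simp: lin_ext_def * fscale_def delta_def if_distrib cong: if_cong)
  qed
  have fin: "finite (supp v)" if "v \<in> free_space {1..n}" for v :: "nat \<Rightarrow> complex"
    using that by (simp add: free_space_def)
  have comp: "lin_ext T (lin_ext S v) = lin_ext (\<lambda>i. lin_ext T (S i)) v"
    if "v \<in> free_space {1..n}" "\<And>i. i \<in> {1..n} \<Longrightarrow> S i \<in> free_space {1..n}"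
    for T :: "nat \<Rightarrow> nat \<Rightarrow> complex" and S and v :: "nat \<Rightarrow> complex"
  proof -
    have *: "lin_ext T (\<Sum>a\<in>A. fscale (v a) (S a)) = (\<Sum>a\<in>A. fscale (v a) (lin_ext T (S a)))
        \<and> (\<Sum>a\<in>A. fscale (v a) (S a)) \<in> free_space {1..n}" if "finite A" "A \<subseteq> {1..n}" for A
      using that
    proof (induction A)
      case empty
      show ?case
        using fv.subspace_0[OF subspace_free_space, of "{1..n}"]
        unfolding sum.empty lin_ext_0 by blast
    next
      case (insert a A)
      have "S a \<in> free_space {1..n}" "fscale (v a) (S a) \<in> free_space {1..n}"
        using insert that \<open>\<And>i. i \<in> {1..n} \<Longrightarrow> S i \<in> free_space {1..n}\<close>
        by (auto intro: fv.subspace_scale[OF subspace_free_space])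
      note Sa = this
      have A: "lin_ext T (\<Sum>a\<in>A. fscale (v a) (S a))
            = (\<Sum>a\<in>A. fscale (v a) (lin_ext T (S a)))"
          "(\<Sum>a\<in>A. fscale (v a) (S a)) \<in> free_space {1..n}"
        using insert.IH insert.prems by auto
      show ?case
        unfolding sum.insert[OF insert.hyps] lin_ext_add[OF fin[OF Sa(2)] fin[OF A(2)]]
          lin_ext_fscale[OF fin[OF Sa(1)]] A(1)
        using fv.subspace_add[OF subspace_free_space Sa(2) A(2)] by blast
    qed
    show ?thesis
      using *[of "supp v"] that(1) by (simp add: lin_ext_def[of _ v] free_space_def)
  qed
  show ?thesis
  proof unfold_locales
    show "fv.subspace (free_space {1..n} :: (nat \<Rightarrow> complex) set)"
      by (rule subspace_free_space)
    have "free_space {1..n} \<subseteq> fv.span (delta ` {1..n} :: (nat \<Rightarrow> complex) set)"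
    proof
      fix v :: "nat \<Rightarrow> complex" assume v: "v \<in> free_space {1..n}"
      have "lin_ext delta v \<in> fv.span (delta ` {1..n})"
        using v by (intro lin_ext_in_subspace fv.subspace_span fv.span_base)
          (auto simp: free_space_def)
      then show "v \<in> fv.span (delta ` {1..n})" using expand[OF v] by simp
    qed
    then show "\<exists>B. finite B \<and> B \<subseteq> free_space {1..n} \<and>
        free_space {1..n} \<subseteq> fv.span (B :: (nat \<Rightarrow> complex) set)"
      by (intro exI[of _ "delta ` {1..n}"]) (auto intro: delta_in_free_space)
  next
    fix g and v :: "nat \<Rightarrow> complex"
    assume g: "g \<in> carrier (sym_group n)" and v: "v \<in> free_space {1..n}"
    have gp: "g permutes {1..n}" using g by (simp add: sym_group_carrier)
    show "perm_rep g v \<in> free_space {1..n}"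
      unfolding perm_rep_def
    proof (intro lin_ext_in_subspace subspace_free_space delta_in_free_space)
      fix i assume "i \<in> supp v"
      then have "i \<in> {1..n}" using v by (auto simp: free_space_def)
      then show "g i \<in> {1..n}" using permutes_in_image[OF gp] by blast
    qed
    show "perm_rep g (fscale c v) = fscale c (perm_rep g v)" for c
      using v by (simp add: perm_rep_def lin_ext_fscale fin)
    show "perm_rep g (v + w) = perm_rep g v + perm_rep g w" if "w \<in> free_space {1..n}" for w
      using v that by (simp add: perm_rep_def lin_ext_add fin)
  next
    fix v :: "nat \<Rightarrow> complex"
    assume v: "v \<in> free_space {1..n}"
    show "perm_rep \<one>\<^bsub>sym_group n\<^esub> v = v"
      using expand[OF v] by (simp add: perm_rep_def sym_group_one)
    fix g h assume h: "h \<in> carrier (sym_group n)"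
    then have hp: "h permutes {1..n}" by (simp add: sym_group_carrier)
    show "perm_rep (g \<otimes>\<^bsub>sym_group n\<^esub> h) v = perm_rep g (perm_rep h v)"
    proof -
      have S: "delta (h i) \<in> free_space {1..n}" if "i \<in> {1..n}" for i
        using permutes_in_image[OF hp] that by (intro delta_in_free_space) blast
      have "lin_ext (\<lambda>i. delta (g i)) (lin_ext (\<lambda>i. delta (h i)) v)
          = lin_ext (\<lambda>i. lin_ext (\<lambda>i. delta (g i) :: nat \<Rightarrow> complex) (delta (h i))) v"
        using v S by (rule comp)
      then show ?thesis
        by (simp only: perm_rep_def sym_group_mult lin_ext_delta comp_def)
    qed
  qed
qed

definition sym_lie_elements :: "nat \<Rightarrow> ((nat \<Rightarrow> nat) \<Rightarrow> complex) set"
  where "sym_lie_elements n =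
    fin_dim_rep.lie_elements (sym_group n) fscale (free_space {1..n}) perm_rep"

end

theory Submission
  imports Defs
begin

text \<open>
  Write an element of the group algebra as \<open>a\<cdot>1 + b\<cdot>s\<close> with \<open>s = (12)\<close>. In degree 0 the Lie
  condition says \<open>a + b = 0\<close>, so only multiples of \<open>1 - s\<close> can be Lie elements. Degree 1 imposes
  nothing. In degree 2 one has \<open>(A\<^sub>2 - B\<^sub>2)(1 - s)(v \<and> w) = - (v - s v) \<and> (w - s w)\<close>, which vanishes
  because the image of \<open>1 - s\<close> is the line through \<open>x\<^sub>1 - x\<^sub>2\<close>. The remaining claims hold because
  \<open>S\<^sub>2\<close> is commutative.
\<close>

section \<open>Calculus of linear extensions\<close>

lemma lin_ext_swap:
  "lin_ext (\<lambda>a. lin_ext (T a) f) x = lin_ext (\<lambda>b. lin_ext (\<lambda>a. T a b) x) f"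
  unfolding lin_ext_def fv.scale_sum_right
  by (subst sum.swap) (simp add: fv.scale_scale mult.commute)

lemma lin_ext_cong: "(\<And>a. a \<in> supp x \<Longrightarrow> S a = T a) \<Longrightarrow> lin_ext S x = lin_ext T x"
  by (simp add: lin_ext_def)

lemma lin_ext_diff_left: "lin_ext (\<lambda>a. S a - T a) x = lin_ext S x - lin_ext T x"
  by (simp add: lin_ext_def fv.scale_right_diff_distrib sum_subtractf)

text \<open>Finiteness of the support is part of the conclusion because the induction step needs it
  to apply \<open>lin_ext_add\<close>.\<close>

lemma lin_ext_sum:
  assumes "finite A" "\<And>a. a \<in> A \<Longrightarrow> finite (supp (F a))"
  shows "finite (supp (sum F A)) \<and> lin_ext T (sum F A) = (\<Sum>a\<in>A. lin_ext T (F a))"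
  using assms
proof (induction A)
  case (insert a A)
  then have "finite (supp (F a))" "finite (supp (sum F A))"
    "lin_ext T (sum F A) = (\<Sum>a\<in>A. lin_ext T (F a))" by auto
  then show ?case
    using finite_subset[OF supp_add[of "F a" "sum F A"]]
    by (simp only: sum.insert[OF insert.hyps] lin_ext_add finite_UnI simp_thms)
qed (simp_all only: sum.empty supp_simps lin_ext_0 finite.emptyI conj_absorb)

lemma lin_ext_lin_ext:
  assumes "finite (supp x)" "\<And>a. a \<in> supp x \<Longrightarrow> finite (supp (S a))"
  shows "lin_ext T (lin_ext S x) = lin_ext (\<lambda>a. lin_ext T (S a)) x"
proof -
  have "finite (supp (fscale (x a) (S a)))" if "a \<in> supp x" for a
    by (rule finite_subset[OF supp_fscale assms(2)[OF that]])
  then have "lin_ext T (lin_ext S x) = (\<Sum>a\<in>supp x. lin_ext T (fscale (x a) (S a)))"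
    unfolding lin_ext_def[of S x]
    using assms(1) by (intro conjunct2[OF lin_ext_sum]) auto
  also have "\<dots> = lin_ext (\<lambda>a. lin_ext T (S a)) x"
    unfolding lin_ext_def[of _ x]
    by (intro sum.cong refl lin_ext_fscale assms(2))
  finally show ?thesis .
qed

lemma sum_fun_apply: "sum F A i = (\<Sum>a\<in>A. F a i)"
  for F :: "'a \<Rightarrow> 'b \<Rightarrow> 'k::comm_monoid_add"
  by (induction A rule: infinite_finite_induct) auto

lemma lin_ext_delta_id:
  assumes "finite (supp x)"
  shows "lin_ext delta x = x"
proof
  fix i
  have "i \<notin> supp x \<Longrightarrow> x i = 0" by (simp add: supp_def)
  then show "lin_ext delta x i = x i"
    using assms
    by (auto simp: lin_ext_def sum_fun_apply fscale_def delta_def if_distrib cong: if_cong)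
qed

text \<open>This spanning set later bounds the dimension of the permutation representation.\<close>

lemma free_space_eq_span: "finite S \<Longrightarrow> free_space S = fv.span (delta ` S)"
proof
  show "free_space S \<subseteq> fv.span (delta ` S :: ('a \<Rightarrow> 'k::field) set)"
  proof
    fix x :: "'a \<Rightarrow> 'k" assume x: "x \<in> free_space S"
    then have "lin_ext delta x \<in> fv.span (delta ` S)"
      by (intro lin_ext_in_subspace fv.subspace_span fv.span_base) (auto simp: free_space_def)
    then show "x \<in> fv.span (delta ` S)" using x by (simp add: lin_ext_delta_id free_space_def)
  qed
  show "fv.span (delta ` S) \<subseteq> free_space S"
    by (intro fv.span_minimal subspace_free_space) (auto intro: delta_in_free_space)
qed

section \<open>Group algebras of commutative groups\<close>

lemma ga_mult_commute:
  assumes "comm_group G" "x \<in> group_algebra G" "y \<in> group_algebra G"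
  shows "ga_mult G x y = ga_mult G y x"
proof -
  interpret comm_group G by fact
  show ?thesis
    \<comment> \<open>After the swap both sides extend over \<open>y\<close> outside and
      \<open>x\<close> inside, so it remains to compare products of two group elements from the
      supports.\<close>
    unfolding ga_mult_def lin_ext_swap[of _ y x]
    using assms(2,3)
    by (intro lin_ext_cong) (auto simp: group_algebra_def free_space_def m_comm subset_iff)
qed

lemma ga_conj_eq_lin_ext:
  assumes "finite (supp x)"
  shows "ga_conj G g x = lin_ext (\<lambda>h. delta (g \<otimes>\<^bsub>G\<^esub> h \<otimes>\<^bsub>G\<^esub> inv\<^bsub>G\<^esub> g)) x"
  using assms by (simp add: ga_conj_def ga_mult_def lin_ext_lin_ext)

text \<open>Conjugation fixes every basis element, so it becomes the linear extension of
  \<open>delta\<close>, which is the identity.\<close>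

lemma ga_conj_trivial:
  assumes "comm_group G" "g \<in> carrier G" "x \<in> group_algebra G"
  shows "ga_conj G g x = x"
proof -
  interpret comm_group G by fact
  have fin: "finite (supp x)" and "supp x \<subseteq> carrier G"
    using assms(3) by (auto simp: group_algebra_def free_space_def)
  moreover have "g \<otimes>\<^bsub>G\<^esub> h \<otimes>\<^bsub>G\<^esub> inv\<^bsub>G\<^esub> g = h" if "h \<in> carrier G" for h
    using assms(2) that by (simp add: m_comm[of g h] m_assoc)
  ultimately have "ga_conj G g x = lin_ext delta x"
    by (simp add: ga_conj_eq_lin_ext) (auto intro!: lin_ext_cong arg_cong[of _ _ delta])
  then show ?thesis using fin by (simp add: lin_ext_delta_id)
qed

section \<open>Lie elements of a general representation\<close>

context fin_dim_rep
begin

definition word_A_minus_B :: "'g \<Rightarrow> 'v list \<Rightarrow> 'v list \<Rightarrow> 'k"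
  where "word_A_minus_B g vs = delta (map (\<rho> g) vs) - word_B g vs"

text \<open>Moving the tensor to the outer position allows the Lie condition to be tested word by
  word.\<close>

lemma lift_A_minus_lift_B:
  "lift_A x f - lift_B x f = lin_ext (\<lambda>vs. lin_ext (\<lambda>g. word_A_minus_B g vs) x) f"
  unfolding lift_A_def lift_B_def word_A_minus_B_def lin_ext_diff_left
  by (simp only: lin_ext_swap[of _ f x])

text \<open>Two cosets agree exactly when their representatives differ by an element of
  \<open>ext_kernel\<close>, and by linearity in the tensor single words suffice. This removes the
  quotient from all later arguments.\<close>

lemma lie_elements_iff:
  "x \<in> lie_elements \<longleftrightarrow> x \<in> group_algebra G \<and>
    (\<forall>m \<le> vec.dim V. \<forall>vs \<in> words m. lin_ext (\<lambda>g. word_A_minus_B g vs) x \<in> ext_kernel m)"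
proof -
  have "(\<forall>X \<in> ext_power m. A_op m x X = B_op m x X) \<longleftrightarrow>
      (\<forall>vs \<in> words m. lin_ext (\<lambda>g. word_A_minus_B g vs) x \<in> ext_kernel m)"
    if x: "x \<in> group_algebra G" for m
  proof -
    have "(\<forall>X \<in> ext_power m. A_op m x X = B_op m x X) \<longleftrightarrow>
        (\<forall>f \<in> free_space (words m). A_op m x (ext_class m f) = B_op m x (ext_class m f))"
      by (auto simp: ext_power_def quotient_def ext_class_def)
    also have "\<dots> \<longleftrightarrow> (\<forall>f \<in> free_space (words m). lift_A x f - lift_B x f \<in> ext_kernel m)"
    proof (intro ball_cong refl)
      fix f :: "'v list \<Rightarrow> 'k" assume f: "f \<in> free_space (words m)"
      note free = lift_in_free[OF x f]
      show "A_op m x (ext_class m f) = B_op m x (ext_class m f) \<longleftrightarrow>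
          lift_A x f - lift_B x f \<in> ext_kernel m"
        unfolding op_class[OF x f] unfolding ext_class_def eq_equiv_class_iff[OF equiv_ext_rel free]
        using free by (simp add: ext_rel_def)
    qed
    also have "\<dots> \<longleftrightarrow> (\<forall>vs \<in> words m. lin_ext (\<lambda>g. word_A_minus_B g vs) x \<in> ext_kernel m)"
      unfolding lift_A_minus_lift_B
    proof (intro iffI ballI)
      fix vs
      assume "\<forall>f \<in> free_space (words m).
          lin_ext (\<lambda>vs. lin_ext (\<lambda>g. word_A_minus_B g vs) x) f \<in> ext_kernel m"
        and "vs \<in> words m"
      \<comment> \<open>A single word is the tensor \<open>delta vs\<close>.\<close>
      from bspec[OF this(1) delta_in_free_space[OF this(2)]]
      show "lin_ext (\<lambda>g. word_A_minus_B g vs) x \<in> ext_kernel m" by simp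
    next
      fix f :: "'v list \<Rightarrow> 'k"
      assume "\<forall>vs \<in> words m. lin_ext (\<lambda>g. word_A_minus_B g vs) x \<in> ext_kernel m"
        and "f \<in> free_space (words m)"
      then show "lin_ext (\<lambda>vs. lin_ext (\<lambda>g. word_A_minus_B g vs) x) f \<in> ext_kernel m"
        by (auto simp: free_space_def intro!: lin_ext_in_subspace[OF subspace_ext_kernel, of f])
    qed
    finally show ?thesis .
  qed
  then show ?thesis by (auto simp: lie_elements_def)
qed

text \<open>For each fixed word the condition in \<open>lie_elements_iff\<close> is linear in
  \<open>x\<close>.\<close>

lemma subspace_lie_elements: "fv.subspace lie_elements"
proof (rule fv.subspaceI)
  fix x y :: "'g \<Rightarrow> 'k" and c :: 'k
  have sub: "fv.subspace (group_algebra G)"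
    by (simp add: group_algebra_def subspace_free_space)
  have fin: "finite (supp z)" if "z \<in> group_algebra G" for z :: "'g \<Rightarrow> 'k"
    using that by (simp add: group_algebra_def free_space_def)
  show "0 \<in> lie_elements"
    unfolding lie_elements_iff lin_ext_0
    using fv.subspace_0[OF sub] fv.subspace_0[OF subspace_ext_kernel] by blast
  assume x: "x \<in> lie_elements"
  then show "fscale c x \<in> lie_elements"
    by (auto simp: lie_elements_iff lin_ext_fscale fin intro: fv.subspace_scale[OF sub]
        fv.subspace_scale[OF subspace_ext_kernel])
  assume "y \<in> lie_elements"
  with x show "x + y \<in> lie_elements"
    by (auto simp: lie_elements_iff lin_ext_add fin intro: fv.subspace_add[OF sub]
        fv.subspace_add[OF subspace_ext_kernel])
qed

section \<open>Exterior relations in degrees 0, 1 and 2\<close>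

lemma ext_kernel_0: "ext_kernel 0 = {0}"
proof -
  \<comment> \<open>Every relation involves words with at least one entry.\<close>
  have "ext_generators 0 = {}" by (auto simp: ext_generators_def words_def)
  then show ?thesis by (simp add: ext_kernel_def)
qed

lemma word_A_minus_B_Nil: "word_A_minus_B g [] = delta []"
  by (simp add: word_A_minus_B_def word_B_def)

lemma word_A_minus_B_singleton: "word_A_minus_B g [v] = 0"
  by (simp add: word_A_minus_B_def word_B_def fun_eq_iff)

lemma word_A_minus_B_pair:
  "word_A_minus_B g [v, w] = delta [\<rho> g v, \<rho> g w] - delta [\<rho> g v, w] - delta [v, \<rho> g w]"
  by (simp add: word_A_minus_B_def word_B_def numeral_2_eq_2)

text \<open>Pulling both scalars out leaves a multiple of the wedge of \<open>e\<close> with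
  itself.\<close>

lemma delta_parallel_pair:
  assumes e: "e \<in> V"
  shows "delta [scale c e, scale d e] \<in> ext_kernel 2"
proof -
  let ?W = "\<lambda>v w. delta [v, w] :: 'v list \<Rightarrow> 'k"
  have 1: "?W (scale c e) (scale d e) - fscale c (?W e (scale d e)) \<in> ext_kernel 2"
    using multilinear_scale[of "[]" e "[scale d e]" 2 c] e subspace_V
    by (simp add: words_def vec.subspace_scale)
  have 2: "?W e (scale d e) - fscale d (?W e e) \<in> ext_kernel 2"
    using multilinear_scale[of "[e]" e "[]" 2 d] e by (simp add: words_def)
  have 3: "?W e e \<in> ext_kernel 2"
    using alternating[of "[]" e "[]" "[]" 2] e by (simp add: words_def)
  have "?W (scale c e) (scale d e) =
      (?W (scale c e) (scale d e) - fscale c (?W e (scale d e)))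
      + fscale c ((?W e (scale d e) - fscale d (?W e e)) + fscale d (?W e e))"
    by simp
  also have "\<dots> \<in> ext_kernel 2"
    by (intro fv.subspace_add fv.subspace_scale subspace_ext_kernel 1 2 3)
  finally show ?thesis .
qed

text \<open>Modulo the relations the difference is minus the wedge of \<open>v - \<rho> g v\<close>
  with \<open>w - \<rho> g w\<close>. Assumption \<open>line\<close> makes both factors multiples of
  \<open>e\<close>.\<close>

lemma word_A_minus_B_pair_rank_one:
  assumes g: "g \<in> carrier G" and e: "e \<in> V" and vw: "v \<in> V" "w \<in> V"
    and line: "v = \<rho> g v + scale c e" "w = \<rho> g w + scale d e"
  shows "word_A_minus_B \<one> [v, w] - word_A_minus_B g [v, w] \<in> ext_kernel 2"
proof -
  let ?W = "\<lambda>v w. delta [v, w] :: 'v list \<Rightarrow> 'k"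
  let ?a = "scale c e" and ?b = "scale d e"
  have in_V: "\<rho> g v \<in> V" "\<rho> g w \<in> V" "?a \<in> V" "?b \<in> V"
    using vw e subspace_V rep_closed[OF g] by (auto simp: vec.subspace_scale)
  have 1: "?W v u - ?W (\<rho> g v) u - ?W ?a u \<in> ext_kernel 2" if "u \<in> V" for u
    using multilinear_add[of "[]" "\<rho> g v" "[u]" 2 ?a] in_V that line(1)[symmetric]
    by (simp add: words_def)
  have 2: "?W ?a w - ?W ?a (\<rho> g w) - ?W ?a ?b \<in> ext_kernel 2"
    using multilinear_add[of "[?a]" "\<rho> g w" "[]" 2 ?b] in_V line(2)[symmetric]
    by (simp add: words_def)
  \<comment> \<open>The first two brackets expand \<open>v\<close> in the first slot, against
    \<open>\<rho> g w\<close> and against \<open>w\<close>; the third expands \<open>w\<close> in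
    the second slot. Only the parallel pair is left over.\<close>
  have "word_A_minus_B \<one> [v, w] - word_A_minus_B g [v, w] =
      (?W v (\<rho> g w) - ?W (\<rho> g v) (\<rho> g w) - ?W ?a (\<rho> g w))
      - (?W v w - ?W (\<rho> g v) w - ?W ?a w)
      - (?W ?a w - ?W ?a (\<rho> g w) - ?W ?a ?b) - ?W ?a ?b"
    using vw by (simp add: word_A_minus_B_pair rep_one)
  also have "\<dots> \<in> ext_kernel 2"
    by (intro fv.subspace_diff[OF subspace_ext_kernel] 1 2 vw in_V delta_parallel_pair e)
  finally show ?thesis .
qed

end

section \<open>The symmetric group on two letters\<close>

lemma carrier_sym_group_2: "carrier (sym_group 2) = {id, transpose 1 2}"
proof -
  have "{1..2} = {1, 2 :: nat}" by auto
  moreover have "p = id \<or> p = transpose 1 2" if "p permutes {1, 2 :: nat}" for p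
    using that by (auto simp: permutes_doubleton_iff)
  ultimately show ?thesis
    by (auto simp: sym_group_def permutes_id permutes_swap_id)
qed

lemma comm_group_sym_group_2: "comm_group (sym_group 2)"
  by (rule group.group_comm_groupI[OF sym_group_is_group])
     (auto simp: carrier_sym_group_2 sym_group_mult)

text \<open>This exhibits the image of \<open>1 - s\<close> inside the line through
  \<open>delta 1 - delta 2\<close>, as the rank-one lemma requires.\<close>

lemma perm_rep_transpose:
  assumes "v \<in> free_space {1..2}"
  shows "v = perm_rep (transpose 1 2) v + fscale (v 1 - v 2) (delta 1 - delta 2)"
proof -
  have "{1..2} = {1, 2 :: nat}" by auto
  with assms have sup: "supp v \<subseteq> {1, 2}" by (simp add: free_space_def)
  then have "v i = 0" if "i \<noteq> 1" "i \<noteq> 2" for i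
    using that by (auto simp: supp_def)
  then show ?thesis
    \<comment> \<open>Summing over all of \<open>{1, 2}\<close> instead of the support gives two
      explicit terms, even if a coordinate vanishes.\<close>
    unfolding perm_rep_def lin_ext_superset[OF _ sup, simplified]
    by (auto simp: fun_eq_iff fscale_def delta_def)
qed

lemma sym_lie_elements_2:
  "sym_lie_elements 2 = fv.span {delta \<one>\<^bsub>sym_group 2\<^esub> - delta (transpose 1 2)}"
proof -
  let ?s = "transpose 1 2 :: nat \<Rightarrow> nat"
  let ?d = "delta id - delta ?s :: (nat \<Rightarrow> nat) \<Rightarrow> complex"
  \<comment> \<open>Otherwise the simplifier would turn the letter 1 into \<open>Suc 0\<close>, and
    facts about \<open>transpose 1 2\<close> would no longer match.\<close>
  note One_nat_def [simp del]
  interpret R: fin_dim_rep "sym_group 2" fscale "free_space {1..2}" perm_rep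
    by (rule fin_dim_rep_perm_rep)
  have one: "\<one>\<^bsub>sym_group 2\<^esub> = id" by (simp add: sym_group_one)
  have s_ne: "id \<noteq> ?s" by (auto simp: fun_eq_iff transpose_def)
  have sub: "fv.subspace (group_algebra (sym_group 2) :: ((nat \<Rightarrow> nat) \<Rightarrow> complex) set)"
    by (simp add: group_algebra_def subspace_free_space)
  have "R.lie_elements \<subseteq> fv.span {?d}"
  proof
    fix x assume lie: "x \<in> R.lie_elements"
    have "[] \<in> R.words 0" by (simp add: R.words_def)
    with lie have x: "x \<in> group_algebra (sym_group 2)"
      and "lin_ext (\<lambda>g. R.word_A_minus_B g []) x \<in> R.ext_kernel 0"
      unfolding R.lie_elements_iff by blast+
    moreover have sup: "supp x \<subseteq> {id, ?s}"
      using x by (simp add: group_algebra_def free_space_def carrier_sym_group_2)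
    \<comment> \<open>The kernel in degree 0 is zero, so the value at the empty word, which is the
      sum of the coefficients of \<open>x\<close>, vanishes.\<close>
    ultimately have "lin_ext (\<lambda>g. delta [] :: (nat \<Rightarrow> complex) list \<Rightarrow> complex) x [] = 0"
      by (simp add: R.ext_kernel_0 R.word_A_minus_B_Nil)
    then have "x id + x ?s = 0"
      using s_ne by (simp add: lin_ext_superset[OF _ sup]) (simp add: fscale_def delta_def)
    then have "x ?s = - x id"
      by (simp add: eq_neg_iff_add_eq_0 add.commute)
    moreover have "x p = 0" if "p \<noteq> id" "p \<noteq> ?s" for p
      using sup that by (auto simp: supp_def)
    ultimately have "x = fscale (x id) ?d"
      using s_ne by (intro ext) (auto simp: fscale_def delta_def)
    then show "x \<in> fv.span {?d}"
      by (metis fv.span_base fv.span_scale singletonI)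
  qed
  moreover have "?d \<in> R.lie_elements"
    unfolding R.lie_elements_iff
  proof (intro conjI allI impI ballI)
    show "?d \<in> group_algebra (sym_group 2)"
      by (intro fv.subspace_diff[OF sub])
         (auto simp: group_algebra_def carrier_sym_group_2 intro: delta_in_free_space)
    fix m vs assume m: "m \<le> fv.dim (free_space {1..2} :: (nat \<Rightarrow> complex) set)"
      and vs: "vs \<in> R.words m"
    \<comment> \<open>The upper bound 2 on the dimension leaves only words of length 0, 1 and 2 to
      check.\<close>
    have "fv.dim (free_space {1..2} :: (nat \<Rightarrow> complex) set)
        \<le> card (delta ` {1..2 :: nat} :: (nat \<Rightarrow> complex) set)"
      by (intro fv.dim_le_card) (simp_all add: free_space_eq_span)
    also have "\<dots> \<le> 2" using card_image_le[of "{1..2 :: nat}"] by fastforce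
    finally have "m \<le> 2" using m by linarith
    moreover have len: "m = length vs" and V: "set vs \<subseteq> free_space {1..2}"
      using vs by (simp_all add: R.words_def)
    ultimately have "length vs = 0 \<or> length vs = Suc 0 \<or> length vs = Suc (Suc 0)"
      by linarith
    then consider "vs = []" | v where "vs = [v]"
      | v w where "vs = [v, w]" "v \<in> free_space {1..2}" "w \<in> free_space {1..2}"
      using V by (auto simp: length_Suc_conv)
    then have "R.word_A_minus_B id vs - R.word_A_minus_B ?s vs \<in> R.ext_kernel m"
    proof cases
      case 1
      then show ?thesis
        using fv.subspace_0[OF R.subspace_ext_kernel]
        by (simp only: R.word_A_minus_B_Nil diff_self)
    next
      case 2
      then show ?thesis
        using fv.subspace_0[OF R.subspace_ext_kernel]
        by (simp only: R.word_A_minus_B_singleton diff_self)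
    next
      case 3
      \<comment> \<open>This vector plays the part of \<open>e\<close> in the rank-one
        lemma.\<close>
      have "delta 1 - delta 2 \<in> (free_space {1..2 :: nat} :: (nat \<Rightarrow> complex) set)"
        by (intro fv.subspace_diff[OF subspace_free_space] delta_in_free_space) auto
      with 3 show ?thesis
        using R.word_A_minus_B_pair_rank_one[OF _ _ _ _ perm_rep_transpose perm_rep_transpose]
        by (simp add: len one carrier_sym_group_2 flip: numeral_2_eq_2)
    qed
    then show "lin_ext (\<lambda>g. R.word_A_minus_B g vs) ?d \<in> R.ext_kernel m"
      by (simp add: lin_ext_diff)
  qed
  then have "fv.span {?d} \<subseteq> R.lie_elements"
    by (intro fv.span_minimal R.subspace_lie_elements) simp
  ultimately show ?thesis
    unfolding sym_lie_elements_def one by (rule equalityI)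
qed

theorem mainTheorem4:
  shows "ga_lie_subalgebra (sym_group 2) (sym_lie_elements 2)
    \<and> fv.dim (sym_lie_elements 2) = 1
    \<and> fv.span {delta \<one>\<^bsub>sym_group 2\<^esub> - delta (transpose 1 2)} = sym_lie_elements 2
    \<and> (\<forall>p\<in>sym_lie_elements 2. \<forall>q\<in>sym_lie_elements 2. ga_bracket (sym_group 2) p q = 0)
    \<and> fin_dim_rep (sym_group 2) fscale (sym_lie_elements 2) (ga_conj (sym_group 2))
    \<and> (\<forall>\<sigma>\<in>carrier (sym_group 2). \<forall>p\<in>sym_lie_elements 2. ga_conj (sym_group 2) \<sigma> p = p)"
proof -
  let ?L = "sym_lie_elements 2"
  let ?d = "delta \<one>\<^bsub>sym_group 2\<^esub> - delta (transpose 1 2) :: (nat \<Rightarrow> nat) \<Rightarrow> complex"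
  have sub: "fv.subspace ?L"
    unfolding sym_lie_elements_2 by (rule fv.subspace_span)
  have alg: "?L \<subseteq> group_algebra (sym_group 2)"
    unfolding sym_lie_elements_def
      fin_dim_rep.lie_elements_def[OF fin_dim_rep_perm_rep] by blast
  have bracket: "ga_bracket (sym_group 2) p q = 0" if "p \<in> ?L" "q \<in> ?L" for p q
    using ga_mult_commute[OF comm_group_sym_group_2, of p q] that alg
    by (auto simp: ga_bracket_def)
  have conj_triv: "ga_conj (sym_group 2) \<sigma> p = p" if "\<sigma> \<in> carrier (sym_group 2)" "p \<in> ?L" for \<sigma> p
    using ga_conj_trivial[OF comm_group_sym_group_2 that(1)] that(2) alg by blast
  \<comment> \<open>The value at \<open>id\<close> is 1. A nonzero vector is independent on its own,
    which gives dimension one.\<close>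
  have "?d \<noteq> 0"
  proof
    assume "?d = 0"
    then have "?d id = 0" by simp
    then show False
      by (auto simp: sym_group_one delta_def fun_eq_iff transpose_def split: if_splits)
  qed
  then have dim: "fv.dim ?L = 1"
    unfolding sym_lie_elements_2 fv.dim_span
    by (subst fv.dim_eq_card_independent) simp_all
  interpret comm_group "sym_group 2" by (rule comm_group_sym_group_2)
  have rep: "fin_dim_rep (sym_group 2) fscale ?L (ga_conj (sym_group 2))"
  \<comment> \<open>Since conjugation acts as the identity on \<open>?L\<close>, the representation
    axioms reduce to closure of a subspace.\<close>
  proof unfold_locales
    show "\<exists>B. finite B \<and> B \<subseteq> ?L \<and> ?L \<subseteq> fv.span B"
      unfolding sym_lie_elements_2
      by (intro exI[of _ "{?d}"] conjI fv.span_superset order_refl) simp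
  qed (simp_all add: sub conj_triv fv.subspace_add fv.subspace_scale)
  show ?thesis
    \<comment> \<open>All brackets are zero, so closure under the bracket amounts to zero lying in
      \<open>?L\<close>.\<close>
    using sub alg bracket conj_triv dim rep fv.subspace_0[OF sub]
    unfolding ga_lie_subalgebra_def sym_lie_elements_2[symmetric] by simp
qed

end
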